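(* If $G$ is a full DAG with an ample framing $F$, then every edge of $G$ lies on a unique exceptional route.
   Context: A DAG is a finite directed acyclic graph, possibly with multiple edges; sources have no incoming edges, sinks no outgoing edges, other vertices are inner; $\mathrm{in}(v),\mathrm{out}(v)$ are incoming/outgoing edges. $G$ is full if every inner vertex $v$ has $|\mathrm{in}(v)|=|\mathrm{out}(v)|=2$. A route is a maximal directed path (source to sink). A framing assigns to each inner vertex $v$ linear orders $\prec$ on $\mathrm{in}(v)$ and $\mathrm{out}(v)$. For inner $v$, paths in $\mathrm{Out}(v)$ (from $v$ to a sink) are compared by $P\prec Q$ iff at the last vertex $w$ of their common initial segment the edge of $P$ leaving $w$ precedes that of $Q$ in $\mathrm{out}(w)$; analogously for $\mathrm{In}(v)$ (paths from a source to $v$) at the first vertex of their common final segment using $\mathrm{in}(w)$. For a route $R$ through $v$, $Rv$, $vR$ are its parts before/after $v$. Routes $P,Q$ through a common inner vertex $v$ conflict at $v$ if, after possibly swapping them, $Pv\prec Qv$ and $vQ\prec vP$; coherent if no conflict at any common inner vertex. A route is exceptional if coherent with all routes. With $\mathcal{F}_+(G)\subset\mathbb{R}^{E(G)}$ the cone of nonnegative flows (conservation at inner vertices) and $v_R$ the indicator vector of $R$, a framing is ample if $\{v_R:R\text{ exceptional}\}$ lies in no facet of $\mathcal{F}_+(G)$ (equivalently, every non-idle edge lies on an exceptional route; an edge is idle if it is the only incoming or only outgoing edge of an inner vertex). *)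

theory Defs
  imports "HOL-Analysis.Analysis" "Graph_Theory.Arc_Walk"
begin

definition dag :: "('v, 'e) pre_digraph \<Rightarrow> bool" where
  "dag G \<longleftrightarrow> fin_digraph G \<and> (\<nexists>c. pre_digraph.cycle G c)"

definition sources :: "('v, 'e) pre_digraph \<Rightarrow> 'v set" where
  "sources G = {v \<in> verts G. in_arcs G v = {}}"

definition sinks :: "('v, 'e) pre_digraph \<Rightarrow> 'v set" where
  "sinks G = {v \<in> verts G. out_arcs G v = {}}"

definition inner_verts :: "('v, 'e) pre_digraph \<Rightarrow> 'v set" where
  "inner_verts G = verts G - sources G - sinks G"

definition full_dag :: "('v, 'e) pre_digraph \<Rightarrow> bool" where
  "full_dag G \<longleftrightarrow> dag G \<and> (\<forall>v\<in>inner_verts G. in_degree G v = 2 \<and> out_degree G v = 2)"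

text \<open>Paths are represented by their lists of arcs, as in the arc walks of the graph library.
  Hence a path of length 0 is the empty list; among the routes it occurs only for an isolated
  vertex.\<close>

definition In_paths :: "('v, 'e) pre_digraph \<Rightarrow> 'v \<Rightarrow> 'e list set" where
  "In_paths G v = {p. \<exists>s\<in>sources G. pre_digraph.apath G s p v}"

definition Out_paths :: "('v, 'e) pre_digraph \<Rightarrow> 'v \<Rightarrow> 'e list set" where
  "Out_paths G v = {p. \<exists>t\<in>sinks G. pre_digraph.apath G v p t}"

definition routes :: "('v, 'e) pre_digraph \<Rightarrow> 'e list set" where
  "routes G = {p. \<exists>s\<in>sources G. \<exists>t\<in>sinks G. pre_digraph.apath G s p t}"

record ('v, 'e) framing =
  in_ord :: "'v \<Rightarrow> 'e rel"
  out_ord :: "'v \<Rightarrow> 'e rel"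

definition is_framing :: "('v, 'e) pre_digraph \<Rightarrow> ('v, 'e) framing \<Rightarrow> bool" where
  "is_framing G F \<longleftrightarrow>
     (\<forall>v\<in>inner_verts G.
        in_ord F v \<subseteq> in_arcs G v \<times> in_arcs G v \<and>
        strict_linear_order_on (in_arcs G v) (in_ord F v) \<and>
        out_ord F v \<subseteq> out_arcs G v \<times> out_arcs G v \<and>
        strict_linear_order_on (out_arcs G v) (out_ord F v))"

text \<open>In \<open>out_prec\<close>, \<open>c\<close> is the common initial segment of \<open>p\<close> and \<open>q\<close>, and its last vertex is
  \<open>tail G a = tail G b\<close>; dually, in \<open>in_prec\<close>, \<open>c\<close> is the common final segment, with first vertex
  \<open>head G a = head G b\<close>.\<close>

definition out_prec ::
  "('v, 'e) pre_digraph \<Rightarrow> ('v, 'e) framing \<Rightarrow> 'e list \<Rightarrow> 'e list \<Rightarrow> bool" where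
  "out_prec G F p q \<longleftrightarrow>
     (\<exists>c a b p' q'. p = c @ a # p' \<and> q = c @ b # q' \<and> a \<noteq> b \<and> (a, b) \<in> out_ord F (tail G a))"

definition in_prec ::
  "('v, 'e) pre_digraph \<Rightarrow> ('v, 'e) framing \<Rightarrow> 'e list \<Rightarrow> 'e list \<Rightarrow> bool" where
  "in_prec G F p q \<longleftrightarrow>
     (\<exists>c a b p' q'. p = p' @ a # c \<and> q = q' @ b # c \<and> a \<noteq> b \<and> (a, b) \<in> in_ord F (head G a))"

text \<open>\<open>splits_at G R v p q\<close>: the route \<open>R\<close> passes through \<open>v\<close>, with \<open>p\<close> and \<open>q\<close> its parts before and
  after \<open>v\<close>.\<close>

definition splits_at ::
  "('v, 'e) pre_digraph \<Rightarrow> 'e list \<Rightarrow> 'v \<Rightarrow> 'e list \<Rightarrow> 'e list \<Rightarrow> bool" where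
  "splits_at G R v p q \<longleftrightarrow> R = p @ q \<and> p \<in> In_paths G v \<and> q \<in> Out_paths G v"

definition conflict_at ::
  "('v, 'e) pre_digraph \<Rightarrow> ('v, 'e) framing \<Rightarrow> 'v \<Rightarrow> 'e list \<Rightarrow> 'e list \<Rightarrow> bool" where
  "conflict_at G F v P Q \<longleftrightarrow>
     (\<exists>Pv vP Qv vQ. splits_at G P v Pv vP \<and> splits_at G Q v Qv vQ \<and>
        (in_prec G F Pv Qv \<and> out_prec G F vQ vP \<or> in_prec G F Qv Pv \<and> out_prec G F vP vQ))"

definition coherent ::
  "('v, 'e) pre_digraph \<Rightarrow> ('v, 'e) framing \<Rightarrow> 'e list \<Rightarrow> 'e list \<Rightarrow> bool" where
  "coherent G F P Q \<longleftrightarrow> (\<forall>v\<in>inner_verts G. \<not> conflict_at G F v P Q)"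

definition exceptional_routes ::
  "('v, 'e) pre_digraph \<Rightarrow> ('v, 'e) framing \<Rightarrow> 'e list set" where
  "exceptional_routes G F = {R \<in> routes G. \<forall>Q\<in>routes G. coherent G F R Q}"

text \<open>The arc type is finite, and the space of real functions on \<open>arcs G\<close> is realised as the
  coordinate subspace of \<open>real ^ 'e\<close> of the vectors supported on \<open>arcs G\<close>.\<close>

definition flow_cone :: "('v, 'e::finite) pre_digraph \<Rightarrow> (real ^ 'e) set" where
  "flow_cone G =
     {x. (\<forall>e. e \<notin> arcs G \<longrightarrow> x $ e = 0) \<and> (\<forall>e\<in>arcs G. 0 \<le> x $ e) \<and>
         (\<forall>v\<in>inner_verts G. (\<Sum>e\<in>in_arcs G v. x $ e) = (\<Sum>e\<in>out_arcs G v. x $ e))}"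

definition route_vec :: "'e list \<Rightarrow> real ^ 'e::finite" where
  "route_vec R = (\<chi> e. if e \<in> set R then 1 else 0)"

definition ample_framing :: "('v, 'e::finite) pre_digraph \<Rightarrow> ('v, 'e) framing \<Rightarrow> bool" where
  "ample_framing G F \<longleftrightarrow>
     is_framing G F \<and>
     (\<nexists>H. H facet_of flow_cone G \<and> route_vec ` exceptional_routes G F \<subseteq> H)"

end

theory Submission
  imports Defs
begin

text \<open>Existence: the flows vanishing on an arc \<open>e\<close> form a proper face of the flow cone, hence lie in
  a facet, so ampleness forces an exceptional route through \<open>e\<close>. Uniqueness: let \<open>c\<close>, \<open>d\<close> be the arcs
  into an inner vertex and \<open>a\<close>, \<open>b\<close> the arcs out of it. If a route enters by \<open>c\<close> and leaves by \<open>a\<close>,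
  where \<open>c\<close> and \<open>a\<close> have different ranks in their respective orders, then it conflicts with every
  route through \<open>d\<close> and \<open>b\<close>. So an exceptional route preserves ranks at inner vertices, and is
  therefore determined by any one of its arcs.\<close>

section \<open>Paths that differ next to the vertex of comparison\<close>

lemma in_prec_snocI:
  assumes "c \<noteq> d" "(c, d) \<in> in_ord F (head G c)"
  shows "in_prec G F (p @ [c]) (q @ [d])"
  unfolding in_prec_def using assms
  \<comment> \<open>The last arcs already differ, so the common final segment is empty.\<close>
  by (intro exI[of _ "[]"] exI[of _ c] exI[of _ d] exI[of _ p] exI[of _ q]) simp

lemma out_prec_ConsI:
  assumes "a \<noteq> b" "(a, b) \<in> out_ord F (tail G a)"
  shows "out_prec G F (a # p) (b # q)"
  unfolding out_prec_def using assms
  by (intro exI[of _ "[]"] exI[of _ a] exI[of _ b] exI[of _ p] exI[of _ q]) simp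

section \<open>Walks and routes in finite acyclic digraphs\<close>

locale finite_dag = fin_digraph +
  assumes no_cycle: "\<nexists>c. cycle c"
begin

text \<open>A repeated vertex would cut a closed walk out of \<open>p\<close>, and a closed walk
  contains a cycle. So concatenating walks never breaks the simplicity that the definitions of paths
  and routes demand.\<close>

lemma awalk_imp_apath:
  assumes "awalk u p v"
  shows "apath u p v"
proof (rule ccontr)
  assume "\<not> apath u p v"
  with assms obtain r where "closed_w r"
    using awalk_not_distinct_decomp[OF assms] by (auto simp: apath_def closed_w_def)
  with closed_w_imp_cycle no_cycle show False by blast
qed

text \<open>A longest walk from \<open>v\<close> must end in a sink, since any arc leaving its end
  would extend it.\<close>

lemma Out_paths_nonempty:
  assumes "v \<in> verts G"
  shows "\<exists>p. p \<in> Out_paths G v"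
proof -
  let ?P = "\<lambda>p. \<exists>t. awalk v p t"
  have "?P []" using assms by (auto simp: awalk_Nil_iff)
  \<comment> \<open>Walks are simple, so their lengths are bounded and a longest one exists.\<close>
  moreover have "\<forall>p. ?P p \<longrightarrow> length p < card (verts G)"
    using awalk_imp_apath length_apath_less by blast
  ultimately have "\<exists>p. ?P p \<and> (\<forall>q. ?P q \<longrightarrow> length q \<le> length p)"
    by (rule Lattices_Big.ex_has_greatest_nat)
  then obtain p where "?P p" and max: "\<And>q. ?P q \<Longrightarrow> length q \<le> length p"
    by blast
  then obtain t where t: "awalk v p t" by blast
  have "out_arcs G t = {}"
  proof (rule ccontr)
    assume "out_arcs G t \<noteq> {}"
    then obtain e where "e \<in> out_arcs G t" by blast
    then have "e \<in> arcs G" "tail G e = t" by simp_all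
    then have "awalk v (p @ [e]) (head G e)"
      using t arc_implies_awalk awalk_appendI by blast
    with max[of "p @ [e]"] show False by auto
  qed
  with t have "t \<in> sinks G" by (auto simp: sinks_def)
  with awalk_imp_apath[OF t] show ?thesis by (auto simp: Out_paths_def)
qed

lemma In_paths_nonempty:
  assumes "v \<in> verts G"
  shows "\<exists>p. p \<in> In_paths G v"
proof -
  let ?P = "\<lambda>p. \<exists>s. awalk s p v"
  have "?P []" using assms by (auto simp: awalk_Nil_iff)
  moreover have "\<forall>p. ?P p \<longrightarrow> length p < card (verts G)"
    using awalk_imp_apath length_apath_less by blast
  ultimately have "\<exists>p. ?P p \<and> (\<forall>q. ?P q \<longrightarrow> length q \<le> length p)"
    by (rule Lattices_Big.ex_has_greatest_nat)
  then obtain p where "?P p" and max: "\<And>q. ?P q \<Longrightarrow> length q \<le> length p"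
    by blast
  then obtain s where s: "awalk s p v" by blast
  have "in_arcs G s = {}"
  proof (rule ccontr)
    assume "in_arcs G s \<noteq> {}"
    then obtain e where "e \<in> in_arcs G s" by blast
    then have "e \<in> arcs G" "head G e = s" by simp_all
    then have "awalk (tail G e) (e # p) v"
      using s by (simp add: awalk_Cons_iff)
    with max[of "e # p"] show False by auto
  qed
  with s have "s \<in> sources G" by (auto simp: sources_def)
  with awalk_imp_apath[OF s] show ?thesis by (auto simp: In_paths_def)
qed

lemma splits_at_imp_route:
  assumes "splits_at G R v p q"
  shows "R \<in> routes G"
proof -
  obtain s t where st: "s \<in> sources G" "t \<in> sinks G" and "awalk s p v" "awalk v q t"
    using assms by (auto simp: splits_at_def In_paths_def Out_paths_def apath_def)
  then have "apath s (p @ q) t" by (intro awalk_imp_apath awalk_appendI)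
  with assms st show ?thesis by (auto simp: splits_at_def routes_def)
qed

lemma In_paths_snoc:
  assumes "p \<in> In_paths G (tail G c)" "c \<in> arcs G"
  shows "p @ [c] \<in> In_paths G (head G c)"
proof -
  obtain s where "s \<in> sources G" "awalk s p (tail G c)"
    using assms(1) by (auto simp: In_paths_def apath_def)
  with assms(2) have "awalk s (p @ [c]) (head G c)"
    using awalk_appendI arc_implies_awalk by blast
  with \<open>s \<in> sources G\<close> awalk_imp_apath show ?thesis
    unfolding In_paths_def by blast
qed

lemma Out_paths_Cons:
  assumes "q \<in> Out_paths G (head G a)" "a \<in> arcs G"
  shows "a # q \<in> Out_paths G (tail G a)"
proof -
  obtain t where "t \<in> sinks G" "awalk (head G a) q t"
    using assms(1) by (auto simp: Out_paths_def apath_def)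
  with assms(2) have "awalk (tail G a) (a # q) t"
    by (simp add: awalk_Cons_iff)
  with \<open>t \<in> sinks G\<close> awalk_imp_apath show ?thesis
    unfolding Out_paths_def by blast
qed

text \<open>Supplies the competing route against which an exceptional route is tested: any incoming
  arc can be followed by any outgoing one.\<close>

lemma route_through_turn:
  assumes c: "c \<in> in_arcs G w" and a: "a \<in> out_arcs G w"
  obtains p q where "splits_at G (p @ c # a # q) w (p @ [c]) (a # q)"
proof -
  obtain p where p: "p \<in> In_paths G (tail G c)" using c In_paths_nonempty by force
  obtain q where q: "q \<in> Out_paths G (head G a)" using a Out_paths_nonempty by force
  have "p @ [c] \<in> In_paths G w"
    using In_paths_snoc[OF p] c by simp
  moreover have "a # q \<in> Out_paths G w"
    using Out_paths_Cons[OF q] a by simp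
  ultimately show thesis using that by (simp add: splits_at_def)
qed

lemma route_through_arc:
  assumes "e \<in> arcs G"
  shows "\<exists>R\<in>routes G. e \<in> set R"
proof -
  obtain p where p: "p \<in> In_paths G (tail G e)" using assms In_paths_nonempty by force
  obtain q where q: "q \<in> Out_paths G (head G e)" using assms Out_paths_nonempty by force
  have "e # q \<in> Out_paths G (tail G e)"
    using Out_paths_Cons[OF q assms] .
  with p have "p @ e # q \<in> routes G"
    using splits_at_imp_route by (simp add: splits_at_def)
  then show ?thesis by force
qed

text \<open>The vertex between two consecutive arcs of a route has an incoming and an outgoing arc,
  so it is neither a source nor a sink.\<close>

lemma route_turn:
  assumes R: "p @ c # a # q \<in> routes G"
  shows "c \<in> in_arcs G (head G c)" "a \<in> out_arcs G (head G c)" "head G c \<in> inner_verts G"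
    and "splits_at G (p @ c # a # q) (head G c) (p @ [c]) (a # q)"
proof -
  from R obtain s t where st: "s \<in> sources G" "t \<in> sinks G" "awalk s (p @ c # a # q) t"
    unfolding routes_def apath_def by blast
  then have p: "awalk s p (tail G c)" and c: "c \<in> arcs G" and a: "a \<in> arcs G" "tail G a = head G c"
    and q: "awalk (head G c) (a # q) t"
    by (auto simp: awalk_Cons_iff)
  show ca: "c \<in> in_arcs G (head G c)" "a \<in> out_arcs G (head G c)" using c a by auto
  then show "head G c \<in> inner_verts G"
    using c by (auto simp: inner_verts_def sources_def sinks_def)
  have "awalk s (p @ [c]) (head G c)"
    using p c awalk_appendI arc_implies_awalk by blast
  with q st awalk_imp_apath show "splits_at G (p @ c # a # q) (head G c) (p @ [c]) (a # q)"
    unfolding splits_at_def In_paths_def Out_paths_def mem_Collect_eq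
      append_assoc append_Cons append_Nil
    by blast
qed

text \<open>In either case a route turning from \<open>d\<close> to \<open>b\<close> would conflict
  with the exceptional one; the two conclusions are the two orientations in the definition of a
  conflict.\<close>

lemma exceptional_turn:
  assumes R: "p @ c # a # q \<in> exceptional_routes G F"
    and d: "d \<in> in_arcs G (head G c)" "d \<noteq> c" and b: "b \<in> out_arcs G (head G c)" "b \<noteq> a"
  shows "\<not> ((c, d) \<in> in_ord F (head G c) \<and> (b, a) \<in> out_ord F (head G c))"
    and "\<not> ((d, c) \<in> in_ord F (head G c) \<and> (a, b) \<in> out_ord F (head G c))"
proof -
  let ?w = "head G c" and ?R = "p @ c # a # q"
  have Rr: "?R \<in> routes G" using R by (simp add: exceptional_routes_def)
  note turn = route_turn[OF Rr]
  obtain p' q' where S: "splits_at G (p' @ d # b # q') ?w (p' @ [d]) (b # q')"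
    using route_through_turn d(1) b(1) by blast
  have "\<not> conflict_at G F ?w ?R (p' @ d # b # q')"
    using R splits_at_imp_route[OF S] turn(3)
    by (auto simp: exceptional_routes_def coherent_def)
  then have noc: "\<not> (in_prec G F (p @ [c]) (p' @ [d]) \<and> out_prec G F (b # q') (a # q))"
    "\<not> (in_prec G F (p' @ [d]) (p @ [c]) \<and> out_prec G F (a # q) (b # q'))"
    using S turn(4) unfolding conflict_at_def by blast+
  have heads: "head G d = ?w" "tail G a = ?w" "tail G b = ?w"
    using d b turn by auto
  \<comment> \<open>Both comparisons are decided at \<open>?w\<close> itself, by the arcs adjacent
    to it.\<close>
  have "(c, d) \<in> in_ord F ?w \<Longrightarrow> in_prec G F (p @ [c]) (p' @ [d])"
    "(d, c) \<in> in_ord F ?w \<Longrightarrow> in_prec G F (p' @ [d]) (p @ [c])"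
    using d(2) heads by (simp_all add: in_prec_snocI)
  moreover have "(a, b) \<in> out_ord F ?w \<Longrightarrow> out_prec G F (a # q) (b # q')"
    "(b, a) \<in> out_ord F ?w \<Longrightarrow> out_prec G F (b # q') (a # q)"
    using b(2) heads by (simp_all add: out_prec_ConsI)
  ultimately show "\<not> ((c, d) \<in> in_ord F ?w \<and> (b, a) \<in> out_ord F ?w)"
    and "\<not> ((d, c) \<in> in_ord F ?w \<and> (a, b) \<in> out_ord F ?w)"
    using noc by blast+
qed

end

lemma exceptional_imp_route: "R \<in> exceptional_routes G F \<Longrightarrow> R \<in> routes G"
  by (simp add: exceptional_routes_def)

section \<open>Uniqueness: an exceptional route is determined by one arc\<close>

locale framed_full_dag = finite_dag G for G :: "('v, 'e) pre_digraph" (structure) +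
  fixes F :: "('v, 'e) framing"
  assumes degrees: "v \<in> inner_verts G \<Longrightarrow> in_degree G v = 2 \<and> out_degree G v = 2"
    and framing: "is_framing G F"
begin

lemma in_ord_total:
  assumes "v \<in> inner_verts G" "c \<in> in_arcs G v" "d \<in> in_arcs G v" "c \<noteq> d"
  shows "(c, d) \<in> in_ord F v \<or> (d, c) \<in> in_ord F v"
  using framing assms unfolding is_framing_def strict_linear_order_on_def total_on_def by blast

lemma out_ord_total:
  assumes "v \<in> inner_verts G" "a \<in> out_arcs G v" "b \<in> out_arcs G v" "a \<noteq> b"
  shows "(a, b) \<in> out_ord F v \<or> (b, a) \<in> out_ord F v"
  using framing assms unfolding is_framing_def strict_linear_order_on_def total_on_def by blast

lemma other_in_arc:
  assumes "v \<in> inner_verts G" "c \<in> in_arcs G v"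
  obtains d where "d \<in> in_arcs G v" "d \<noteq> c"
  using degrees[OF assms(1)] assms(2) unfolding in_degree_def card_2_iff by blast

lemma other_out_arc:
  assumes "v \<in> inner_verts G" "a \<in> out_arcs G v"
  obtains b where "b \<in> out_arcs G v" "b \<noteq> a"
  using degrees[OF assms(1)] assms(2) unfolding out_degree_def card_2_iff by blast

text \<open>Compare \<open>c\<close> with the other incoming arc \<open>d\<close>, and
  \<open>a\<close> with \<open>a'\<close>. Of the four combinations of orders, coherence of the
  first route excludes two and coherence of the second excludes the other two.\<close>

lemma exceptional_next_arc_unique:
  assumes P: "p @ c # a # q \<in> exceptional_routes G F"
    and Q: "p' @ c # a' # q' \<in> exceptional_routes G F"
  shows "a = a'"
proof (rule ccontr)
  assume ne: "a \<noteq> a'"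
  note tP = route_turn[OF exceptional_imp_route[OF P]]
    and tQ = route_turn[OF exceptional_imp_route[OF Q]]
  obtain d where d: "d \<in> in_arcs G (head G c)" "d \<noteq> c"
    using other_in_arc tP by blast
  show False
    using exceptional_turn[OF P d tQ(2)] exceptional_turn[OF Q d tP(2)] ne
      in_ord_total[OF tP(3,1) d(1)] out_ord_total[OF tP(3,2) tQ(2)] d(2) by blast
qed

lemma exceptional_prev_arc_unique:
  assumes P: "p @ c # a # q \<in> exceptional_routes G F"
    and Q: "p' @ c' # a # q' \<in> exceptional_routes G F"
  shows "c = c'"
proof (rule ccontr)
  assume ne: "c \<noteq> c'"
  note tP = route_turn[OF exceptional_imp_route[OF P]]
    and tQ = route_turn[OF exceptional_imp_route[OF Q]]
  \<comment> \<open>Both vertices are the tail of the shared arc \<open>a\<close>.\<close>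
  have w: "head G c' = head G c" using tP(2) tQ(2) by (metis in_out_arcs_conv)
  note tQ = tQ[unfolded w]
  obtain b where b: "b \<in> out_arcs G (head G c)" "b \<noteq> a"
    using other_out_arc tP by blast
  show False
    using exceptional_turn[OF P tQ(1) _ b] exceptional_turn[OF Q, unfolded w, OF tP(1) _ b] ne
      in_ord_total[OF tP(3,1) tQ(1)] out_ord_total[OF tP(3,2) b(1)] b(2) by blast
qed

text \<open>The two routes are followed forward from \<open>c\<close>, one forced arc at a time.
  They also stop together: one ending at the head of \<open>c\<close> makes it a sink, one
  continuing makes it inner.\<close>

lemma exceptional_suffix_unique:
  assumes "p @ c # q \<in> exceptional_routes G F" "p' @ c # q' \<in> exceptional_routes G F"
  shows "q = q'"
  using assms
proof (induction q arbitrary: p p' c q')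
  case Nil
  have "head G c \<in> sinks G"
    using Nil.prems(1) exceptional_imp_route
    by (fastforce simp: routes_def apath_def awalk_simps)
  show ?case
  proof (cases q')
    case (Cons a q)
    with Nil.prems(2) have "head G c \<in> inner_verts G"
      using route_turn(3) by (auto simp: exceptional_routes_def)
    with \<open>head G c \<in> sinks G\<close> show ?thesis by (simp add: inner_verts_def)
  qed simp
next
  case (Cons a q)
  show ?case
  proof (cases q')
    case Nil
    have "head G c \<in> sinks G"
      using Cons.prems(2) Nil exceptional_imp_route
      by (fastforce simp: routes_def apath_def awalk_simps)
    moreover have "head G c \<in> inner_verts G"
      using Cons.prems(1) route_turn(3) by (auto simp: exceptional_routes_def)
    ultimately show ?thesis by (simp add: inner_verts_def)
  next
    case (Cons a' r)
    have "a = a'"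
      using exceptional_next_arc_unique Cons.prems \<open>q' = a' # r\<close> by blast
    \<comment> \<open>The arc \<open>c\<close> moves into the prefixes, and \<open>a\<close> becomes
      the shared arc.\<close>
    moreover have "q = r"
      using Cons.IH[of "p @ [c]" a "p' @ [c]" r] Cons.prems \<open>q' = a' # r\<close> \<open>a = a'\<close> by simp
    ultimately show ?thesis using \<open>q' = a' # r\<close> by simp
  qed
qed

text \<open>The same argument run backward; reverse induction exposes the arc just before
  \<open>c\<close>, and sources replace sinks.\<close>

lemma exceptional_prefix_unique:
  assumes "p @ c # q \<in> exceptional_routes G F" "p' @ c # q' \<in> exceptional_routes G F"
  shows "p = p'"
  using assms
proof (induction p arbitrary: p' c q q' rule: rev_induct)
  case Nil
  have "tail G c \<in> sources G"
    using Nil.prems(1) exceptional_imp_route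
    by (fastforce simp: routes_def apath_def awalk_simps)
  show ?case
  proof (cases p' rule: rev_cases)
    case (snoc p a)
    with Nil.prems(2) have "tail G c \<in> inner_verts G"
      using route_turn(2,3) by (fastforce simp: exceptional_routes_def)
    with \<open>tail G c \<in> sources G\<close> show ?thesis by (simp add: inner_verts_def)
  qed simp
next
  case (snoc a p)
  show ?case
  proof (cases p' rule: rev_cases)
    case Nil
    have "tail G c \<in> sources G"
      using snoc.prems(2) Nil exceptional_imp_route
      by (fastforce simp: routes_def apath_def awalk_simps)
    moreover have "tail G c \<in> inner_verts G"
      using snoc.prems(1) route_turn(2,3) by (fastforce simp: exceptional_routes_def)
    ultimately show ?thesis by (simp add: inner_verts_def)
  next
    case p': (snoc r a')
    have "a = a'"
      using exceptional_prev_arc_unique[of p a c q r a' q'] snoc.prems p' by simp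
    moreover have "p = r"
      using snoc.IH[of a "c # q" r "c # q'"] snoc.prems p' \<open>a = a'\<close> by simp
    ultimately show ?thesis using p' by simp
  qed
qed

lemma exceptional_route_through_arc_unique:
  assumes "P \<in> exceptional_routes G F" "Q \<in> exceptional_routes G F" "e \<in> set P" "e \<in> set Q"
  shows "P = Q"
proof -
  obtain p q p' q' where "P = p @ e # q" "Q = p' @ e # q'"
    using assms(3,4) by (meson split_list)
  then show ?thesis
    using assms(1,2) exceptional_prefix_unique exceptional_suffix_unique by blast
qed

end

section \<open>Existence: the flow cone and its facets\<close>

lemma (in fin_digraph) sum_arcs_of_awalk:
  assumes "awalk u p v" "distinct p"
  shows "(\<Sum>e\<in>in_arcs G w. of_bool (e \<in> set p)) + (of_bool (u = w) :: real) =
    (\<Sum>e\<in>out_arcs G w. of_bool (e \<in> set p)) + of_bool (v = w)"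
  using assms
proof (induction p arbitrary: u)
  case Nil
  then show ?case by (simp add: awalk_Nil_iff)
next
  case (Cons a p)
  then have a: "a \<in> arcs G" "u = tail G a" "a \<notin> set p"
    and IH: "(\<Sum>e\<in>in_arcs G w. of_bool (e \<in> set p)) + (of_bool (head G a = w) :: real) =
      (\<Sum>e\<in>out_arcs G w. of_bool (e \<in> set p)) + of_bool (v = w)"
    by (auto simp: awalk_Cons_iff)
  \<comment> \<open>Distinctness prevents \<open>a\<close> from being counted twice, so indicators
    add up. The first arc then moves the unit of inflow at the start of the walk from
    \<open>tail G a\<close> to \<open>head G a\<close>.\<close>
  have "(of_bool (e \<in> set (a # p)) :: real) = of_bool (e = a) + of_bool (e \<in> set p)" for e
    using a(3) by auto
  moreover have "(\<Sum>e\<in>in_arcs G w. of_bool (e = a)) = (of_bool (head G a = w) :: real)"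
    "(\<Sum>e\<in>out_arcs G w. of_bool (e = a)) = (of_bool (tail G a = w) :: real)"
    using a(1) finite_in_arcs[of w] finite_out_arcs[of w]
    by (simp_all add: of_bool_def)
  ultimately show ?case using IH a(2) by (simp add: sum.distrib)
qed

lemma route_vec_in_flow_cone:
  fixes G :: "('v, 'e::finite) pre_digraph"
  assumes "fin_digraph G" "R \<in> routes G"
  shows "route_vec R \<in> flow_cone G"
proof -
  interpret fin_digraph G by fact
  obtain s t where s: "s \<in> sources G" and t: "t \<in> sinks G" and R: "apath s R t"
    using assms(2) by (auto simp: routes_def)
  then have walk: "awalk s R t" "distinct R"
    using distinct_verts_imp_distinct by (auto simp: apath_def)
  have "(\<Sum>e\<in>in_arcs G v. of_bool (e \<in> set R)) = (\<Sum>e\<in>out_arcs G v. of_bool (e \<in> set R) :: real)"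
    if "v \<in> inner_verts G" for v
  proof -
    \<comment> \<open>The ends of a route are not inner, so the correction terms of the walk
      identity vanish.\<close>
    have "s \<noteq> v" "t \<noteq> v" using that s t by (auto simp: inner_verts_def)
    then show ?thesis using sum_arcs_of_awalk[OF walk, of v] by simp
  qed
  moreover have "set R \<subseteq> arcs G" using walk(1) by blast
  ultimately show ?thesis
    unfolding flow_cone_def route_vec_def by (auto simp: of_bool_def)
qed

lemma polyhedron_flow_cone:
  fixes G :: "('v, 'e::finite) pre_digraph"
  assumes "finite (verts G)"
  shows "polyhedron (flow_cone G)"
proof -
  \<comment> \<open>The inner product with \<open>?net v\<close> is inflow minus outflow at
    \<open>v\<close>, which turns conservation into a hyperplane.\<close>
  let ?net = "\<lambda>v. (\<Sum>e\<in>in_arcs G v. axis e 1) - (\<Sum>e\<in>out_arcs G v. axis e 1) :: real ^ 'e"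
  have "flow_cone G = (\<Inter>e\<in>- arcs G. {x. axis e 1 \<bullet> x = 0}) \<inter> (\<Inter>e\<in>arcs G. {x. axis e 1 \<bullet> x \<ge> 0})
      \<inter> (\<Inter>v\<in>inner_verts G. {x. ?net v \<bullet> x = 0})"
    unfolding flow_cone_def
    by (auto simp: inner_diff_left inner_sum_left inner_axis')
  moreover have "finite (inner_verts G)"
    using assms by (simp add: inner_verts_def)
  ultimately show ?thesis
    by (auto intro!: polyhedron_Int polyhedron_Inter polyhedron_hyperplane polyhedron_halfspace_ge)
qed

lemma ample_imp_exceptional_route_through_arc:
  fixes G :: "('v, 'e::finite) pre_digraph"
  assumes "finite_dag G" and ample: "ample_framing G F" and e: "e \<in> arcs G"
  shows "\<exists>R\<in>exceptional_routes G F. e \<in> set R"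
proof (rule ccontr)
  assume none: "\<not> ?thesis"
  interpret finite_dag G by fact
  note route_vec_in_flow_cone = route_vec_in_flow_cone[OF fin_digraph_axioms]
  let ?C = "flow_cone G" and ?H = "flow_cone G \<inter> {x. axis e 1 \<bullet> x = 0}"
  have poly: "polyhedron ?C" using polyhedron_flow_cone[OF finite_verts] .
  have "?H face_of ?C"
  proof (rule face_of_Int_supporting_hyperplane_ge)
    show "convex ?C" using poly by (rule polyhedron_imp_convex)
    show "axis e 1 \<bullet> x \<ge> 0" if "x \<in> ?C" for x
      using that e by (simp add: flow_cone_def inner_axis')
  qed
  \<comment> \<open>A face lies in a facet once it is nonempty and proper. The zero flow gives the
    former, a route through \<open>e\<close> the latter.\<close>
  moreover have "0 \<in> ?H" by (simp add: flow_cone_def)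
  moreover have "?H \<noteq> ?C"
  proof -
    obtain R where R: "R \<in> routes G" "e \<in> set R" using route_through_arc e by blast
    then have "route_vec R \<in> ?C" using route_vec_in_flow_cone by blast
    moreover have "route_vec R \<notin> ?H" using R(2) by (simp add: route_vec_def inner_axis')
    ultimately show ?thesis by blast
  qed
  ultimately obtain K where K: "K facet_of ?C" "?H \<subseteq> K"
    using face_of_polyhedron_subset_facet[OF poly] by blast
  \<comment> \<open>If every exceptional route avoids \<open>e\<close>, all their vectors vanish in
    that coordinate and so lie in the facet \<open>K\<close>, against ampleness.\<close>
  have "route_vec ` exceptional_routes G F \<subseteq> ?H"
    using none route_vec_in_flow_cone
    by (auto simp: exceptional_routes_def route_vec_def inner_axis')
  with K ample show False unfolding ample_framing_def by blast
qed

theorem theorem3p4: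
  fixes G :: "('v, 'e::finite) pre_digraph" and F :: "('v, 'e) framing"
  assumes "full_dag G" and "ample_framing G F"
  shows "\<forall>e\<in>arcs G. \<exists>!R. R \<in> exceptional_routes G F \<and> e \<in> set R"
proof -
  interpret fin_digraph G
    using assms(1) by (simp add: full_dag_def dag_def)
  interpret framed_full_dag G F
    using assms by unfold_locales (auto simp: full_dag_def dag_def ample_framing_def)
  show ?thesis
    using ample_imp_exceptional_route_through_arc[OF finite_dag_axioms assms(2)]
      exceptional_route_through_arc_unique
    by blast
qed

end
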